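(* Let $A_i\in\mathbb{C}_{\rm H}^{m_i}$ and $B_i\in\mathbb{C}^{m_i\times n}$ be given for $i=1,2,3$, and suppose that each pair of the three matrix equations $$B_1XB_1^{*}=A_1,\quad B_2XB_2^{*}=A_2,\quad B_3XB_3^{*}=A_3$$ has a common Hermitian solution. Then there exists a Hermitian matrix $X\in\mathbb{C}_{\rm H}^{n}$ satisfying all three equations simultaneously if and only if $$r\begin{bmatrix} A_1 & 0 & 0 & B_1 & B_1 \\ 0 & -A_2 & 0 & B_2 & 0 \\ 0 & 0 & -A_3 & 0 & B_3 \\ B_1^{*} & B_2^{*} & B_3^{*} & 0 & 0 \end{bmatrix}=r\begin{bmatrix} B_1 & B_1 \\ B_2 & 0 \\ 0 & B_3 \end{bmatrix}+r[B_1^{*},B_2^{*},B_3^{*}].$$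
   Context: $\mathbb{C}_{\rm H}^{m}$ is the set of $m\times m$ complex Hermitian matrices, $A^{*}$ is the conjugate transpose, $r(\cdot)$ denotes matrix rank, and $[A,B,C]$ denotes a row block matrix. *)

theory Defs
  imports "HOL-Analysis.Analysis"
begin

definition conj_transpose :: "complex^'n^'m \<Rightarrow> complex^'m^'n" where
  "conj_transpose A = (\<chi> i j. cnj (A $ j $ i))"

definition hermitian :: "complex^'n^'n \<Rightarrow> bool" where
  "hermitian A \<longleftrightarrow> conj_transpose A = A"

text \<open>
  Block matrices are indexed by sum types: \<open>A ||| B\<close> is \<open>[A, B]\<close>, and \<open>A /// B\<close>
  is \<open>A\<close> on top of \<open>B\<close>. Both associate to the right, and \<open>|||\<close> binds tighter, so a
  block matrix is written row by row, with \<open>///\<close> between the rows.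
\<close>

definition hcat :: "'a^'n^'m \<Rightarrow> 'a^'p^'m \<Rightarrow> 'a^('n + 'p)^'m"  (infixr "|||" 60) where
  "A ||| B = (\<chi> i j. case j of Inl k \<Rightarrow> A $ i $ k | Inr k \<Rightarrow> B $ i $ k)"

definition vcat :: "'a^'n^'m \<Rightarrow> 'a^'n^'p \<Rightarrow> 'a^'n^('m + 'p)"  (infixr "'/'/'/" 55) where
  "A /// B = (\<chi> i. case i of Inl k \<Rightarrow> A $ k | Inr k \<Rightarrow> B $ k)"

end

theory Submission
  imports Defs
begin

text \<open>
  Let \<open>L\<^sub>i\<close> be the row space of \<open>B\<^sub>i\<close> and \<open>R\<^sub>i\<close> the column space of \<open>B\<^sub>i\<^sup>*\<close>. The equation
  \<open>B\<^sub>i X B\<^sub>i\<^sup>* = A\<^sub>i\<close> prescribes the bilinear form of \<open>X\<close> on \<open>L\<^sub>i \<times> R\<^sub>i\<close>. By rank-nullity, the rank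
  equation says that whenever \<open>x B\<^sub>1 = - y B\<^sub>2 = - z B\<^sub>3\<close>, the vector \<open>(x A\<^sub>1, - y A\<^sub>2, - z A\<^sub>3)\<close> lies in
  the row space of \<open>[B\<^sub>1\<^sup>*, B\<^sub>2\<^sup>*, B\<^sub>3\<^sup>*]\<close>. A common solution \<open>X\<close> provides the coefficients
  \<open>x B\<^sub>1 X\<close>.

  Conversely, let \<open>X\<close> solve the first two equations and \<open>Y\<close> the first and the third. It suffices
  to find a form \<open>Z\<close> that vanishes on \<open>L\<^sub>1 \<times> R\<^sub>1\<close> and \<open>L\<^sub>2 \<times> R\<^sub>2\<close> and agrees with \<open>D = Y - X\<close> on
  \<open>L\<^sub>3 \<times> R\<^sub>3\<close>. Pairwise solvability makes \<open>D\<close> vanish on \<open>(L\<^sub>1 \<inter> L\<^sub>3) \<times> (R\<^sub>1 \<inter> R\<^sub>3)\<close> and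
  \<open>(L\<^sub>2 \<inter> L\<^sub>3) \<times> (R\<^sub>2 \<inter> R\<^sub>3)\<close>; the rank condition makes it vanish on
  \<open>(L\<^sub>1 \<inter> L\<^sub>2 \<inter> L\<^sub>3) \<times> (R\<^sub>3 \<inter> (R\<^sub>1 + R\<^sub>2))\<close>, and on the mirrored product because \<open>D\<close> is Hermitian.
  These conditions are exactly what is needed to build \<open>Z\<close> out of \<open>D\<close> and projections. The
  Hermitian part of \<open>X + Z\<close> is then a common solution.
\<close>

section \<open>The bilinear pairing \<open>dotp\<close>, free of conjugation, and matrix equations
  as conditions on forms\<close>

definition dotp :: "'a::field^'n \<Rightarrow> 'a^'n \<Rightarrow> 'a" where
  "dotp x y = (\<Sum>i\<in>UNIV. x $ i * y $ i)"

lemma dotp_add_left: "dotp (x + y) z = dotp x z + dotp y z"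
  by (simp add: dotp_def algebra_simps sum.distrib)

lemma dotp_add_right: "dotp x (y + z) = dotp x y + dotp x z"
  by (simp add: dotp_def algebra_simps sum.distrib)

lemma dotp_diff_left: "dotp (x - y) z = dotp x z - dotp y z"
  by (simp add: dotp_def algebra_simps sum_subtractf)

lemma dotp_diff_right: "dotp x (y - z) = dotp x y - dotp x z"
  by (simp add: dotp_def algebra_simps sum_subtractf)

lemma dotp_zero [simp]: "dotp 0 x = 0" "dotp x 0 = 0"
  by (simp_all add: dotp_def)

lemma dotp_vector_matrix: "dotp (x v* A) y = dotp x (A *v y)"
proof -
  have "dotp (x v* A) y = (\<Sum>j\<in>UNIV. \<Sum>i\<in>UNIV. A $ i $ j * x $ i * y $ j)"
    by (simp add: dotp_def vector_matrix_mult_def sum_distrib_right sum_distrib_left ac_simps)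
  also have "\<dots> = (\<Sum>i\<in>UNIV. \<Sum>j\<in>UNIV. A $ i $ j * x $ i * y $ j)"
    by (rule sum.swap)
  also have "\<dots> = dotp x (A *v y)"
    by (simp add: dotp_def matrix_vector_mult_def sum_distrib_left ac_simps)
  finally show ?thesis .
qed

lemma dotp_eqI:
  fixes y z :: "'a::field^'n"
  assumes "\<And>x. dotp x y = dotp x z"
  shows "y = z"
proof (rule iffD2[OF vec_eq_iff], rule allI)
  fix i
  have "dotp (axis i 1) u = u $ i" for u :: "'a^'n"
    by (simp add: dotp_def axis_def if_distrib[of "\<lambda>t. t * _"] cong: if_cong)
  then show "y $ i = z $ i"
    using assms[of "axis i 1"] by simp
qed

text \<open>The left argument runs through the row space of \<open>B\<close> and the right one
  through the column space of \<open>C\<close>, so the equation fixes the form of \<open>X\<close>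
  on the product of these two spaces and nothing else.\<close>

lemma matrix_product_eq_iff_dotp:
  fixes B :: "'a::field^'n^'m"
  shows "B ** X ** C = A \<longleftrightarrow> (\<forall>x y. dotp (x v* B) (X *v (C *v y)) = dotp x (A *v y))"
  (is "?l \<longleftrightarrow> ?r")
proof
  assume ?l
  then show ?r
    by (auto simp: dotp_vector_matrix matrix_vector_mul_assoc matrix_mul_assoc)
next
  assume ?r
  then have "dotp x ((B ** X ** C) *v y) = dotp x (A *v y)" for x y
    by (auto simp: dotp_vector_matrix matrix_vector_mul_assoc matrix_mul_assoc)
  then show ?l
    unfolding matrix_eq by (blast intro: dotp_eqI)
qed

lemma linear_vector_matrix_mult: "Vector_Spaces.linear (*s) (*s) (\<lambda>x. x v* (A :: 'a::field^'n^'m))"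
proof -
  have "(\<lambda>x. x v* A) = (*v) (transpose A)"
    by auto
  then show ?thesis
    using matrix_vector_mul_linear_gen[of "transpose A"] by metis
qed

section \<open>Projections and linear maps with prescribed behaviour on subspaces\<close>

lemma exists_projection:
  fixes V :: "('a::field^'n) set"
  assumes "vec.subspace V"
  obtains P :: "'a^'n^'n" where "\<And>x. P *v x \<in> V" "\<And>x. x \<in> V \<Longrightarrow> P *v x = x"
proof -
  \<comment> \<open>A left inverse of the identity on \<open>V\<close> with range inside
    \<open>V\<close> is a projection onto \<open>V\<close>.\<close>
  obtain g :: "'a^'n \<Rightarrow> 'a^'n" where g: "g ` UNIV \<subseteq> V" "Vector_Spaces.linear (*s) (*s) g" "\<forall>v\<in>V. g (id v) = v"
    using vec.linear_exists_left_inverse_on[OF vec.linear_id assms] by auto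
  show thesis
    by (rule that[of "matrix g"]) (use g in \<open>auto simp: matrix_works[OF g(2)]\<close>)
qed

text \<open>The complement of a projection onto \<open>V\<close>: it selects linearly one
  representative of each class modulo \<open>V\<close>.\<close>

lemma exists_coprojection:
  fixes V :: "('a::field^'n) set"
  assumes "vec.subspace V"
  obtains N :: "'a^'n^'n" where "\<And>x. x - N *v x \<in> V" "\<And>x. x \<in> V \<Longrightarrow> N *v x = 0"
proof -
  obtain P :: "'a^'n^'n" where P: "\<And>x. P *v x \<in> V" "\<And>x. x \<in> V \<Longrightarrow> P *v x = x"
    using exists_projection[OF assms] by metis
  show thesis
    by (rule that[of "mat 1 - P"]) (simp_all add: P matrix_vector_mult_diff_rdistrib)
qed

text \<open>The two prescriptions agree on the overlap of \<open>U\<close> and \<open>V\<close>, so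
  they glue. For an explicit matrix, reduce \<open>U\<close> modulo the overlap by \<open>K\<close>;
  on this reduced space \<open>N\<close>, which kills \<open>V\<close>, is injective and can be
  undone before \<open>F\<close> is applied.\<close>

lemma exists_matrix_eq_on_zero_on:
  fixes F :: "'a::field^'n^'m"
  assumes U: "vec.subspace U" and V: "vec.subspace V"
    and F: "\<And>x. x \<in> U \<Longrightarrow> x \<in> V \<Longrightarrow> F *v x = 0"
  obtains E :: "'a^'n^'m" where "\<And>x. x \<in> U \<Longrightarrow> E *v x = F *v x" "\<And>x. x \<in> V \<Longrightarrow> E *v x = 0"
proof -
  have UV: "vec.subspace (U \<inter> V)"
    using U V by (rule vec.subspace_inter)
  obtain N :: "'a^'n^'n" where N: "\<And>x. x - N *v x \<in> V" "\<And>x. x \<in> V \<Longrightarrow> N *v x = 0"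
    using exists_coprojection[OF V] by metis
  obtain K :: "'a^'n^'n" where K: "\<And>x. x - K *v x \<in> U \<inter> V" "\<And>x. x \<in> U \<inter> V \<Longrightarrow> K *v x = 0"
    using exists_coprojection[OF UV] by metis
  have KU: "K *v x \<in> U" if "x \<in> U" for x
    using vec.subspace_diff[OF U that, of "x - K *v x"] K(1)[of x] by simp
  have "vec.subspace ((*v) K ` U)"
    by (rule vec.subspace_image) (rule U)
  \<comment> \<open>A difference \<open>K *v c\<close> killed by \<open>N\<close> lies in
    \<open>V\<close>, hence in the overlap; then so does \<open>c\<close>, and \<open>K\<close>
    kills it.\<close>
  moreover have "inj_on ((*v) N) ((*v) K ` U)"
  proof (rule inj_onI)
    fix x y assume xy: "x \<in> (*v) K ` U" "y \<in> (*v) K ` U" and eq: "N *v x = N *v y"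
    from xy obtain a b where ab: "a \<in> U" "b \<in> U" "x = K *v a" "y = K *v b"
      by auto
    define c where "c = a - b"
    have c: "c \<in> U" "x - y = K *v c"
      using ab vec.subspace_diff[OF U] by (auto simp: c_def matrix_vector_mult_diff_distrib)
    have "N *v (x - y) = 0"
      using eq by (simp add: matrix_vector_mult_diff_distrib)
    then have "x - y \<in> V"
      using N(1)[of "x - y"] by simp
    then have "K *v c \<in> U \<inter> V"
      using c KU by auto
    moreover have "c - K *v c \<in> U \<inter> V"
      by (rule K(1))
    ultimately have "(c - K *v c) + K *v c \<in> U \<inter> V"
      using vec.subspace_add[OF UV] by blast
    then have "K *v c = 0"
      using K(2) by simp
    then show "x = y"
      using c by simp
  qed
  ultimately obtain g where g: "Vector_Spaces.linear (*s) (*s) g" "\<And>v. v \<in> (*v) K ` U \<Longrightarrow> g (N *v v) = v"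
    using vec.linear_exists_left_inverse_on[OF matrix_vector_mul_linear_gen] by blast
  show thesis
  \<comment> \<open>For \<open>x\<close> in \<open>U\<close>, \<open>N\<close> does not distinguish
    \<open>x\<close> from \<open>K *v x\<close>, \<open>g\<close> recovers \<open>K *v x\<close>,
    and \<open>F\<close> takes the same value there as at \<open>x\<close>.\<close>
  proof (rule that[of "F ** matrix g ** N"])
    fix x assume x: "x \<in> U"
    have "N *v x = N *v (x - K *v x) + N *v (K *v x)"
      by (simp add: matrix_vector_mult_diff_distrib)
    then have "N *v x = N *v (K *v x)"
      using N(2) K(1)[of x] by simp
    then have "g (N *v x) = K *v x"
      using g(2) x by simp
    moreover have "F *v (K *v x) = F *v x"
      using F[of "x - K *v x"] K(1)[of x] by (simp add: matrix_vector_mult_diff_distrib)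
    ultimately show "(F ** matrix g ** N) *v x = F *v x"
      by (simp add: matrix_works[OF g(1)] flip: matrix_vector_mul_assoc)
  next
    fix x assume "x \<in> V"
    then show "(F ** matrix g ** N) *v x = 0"
      by (simp add: N(2) flip: matrix_vector_mul_assoc)
  qed
qed

text \<open>
  Modulo \<open>V1 \<inter> V2 \<inter> Q\<close>, the space \<open>Q\<close> is the direct sum of \<open>V1 \<inter> Q\<close>, \<open>V2 \<inter> Q\<close> and a complement.
  The three projections are \<open>E1\<close>, \<open>E2\<close> and \<open>R1 = R2\<close>, extended from \<open>Q\<close> to the whole space so
  as to vanish on \<open>V1\<close> or on \<open>V2\<close>; the last one vanishes on both \<open>V1 \<inter> Q\<close> and \<open>V2 \<inter> Q\<close> and so
  has an extension of either kind, but in general no extension that vanishes on \<open>V1 + V2\<close>.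
\<close>

lemma exists_splitting_maps:
  fixes V1 V2 Q :: "('a::field^'n) set"
  assumes V1: "vec.subspace V1" and V2: "vec.subspace V2" and Q: "vec.subspace Q"
  obtains E1 E2 R1 R2 :: "'a^'n^'n"
  where "\<And>x. x \<in> V2 \<Longrightarrow> E1 *v x = 0" "\<And>x. x \<in> V1 \<Longrightarrow> E2 *v x = 0"
    and "\<And>x. x \<in> V1 \<Longrightarrow> R1 *v x = 0" "\<And>x. x \<in> V2 \<Longrightarrow> R2 *v x = 0"
    and "\<And>x. x \<in> Q \<Longrightarrow> E1 *v x \<in> V1 \<inter> Q" "\<And>x. x \<in> Q \<Longrightarrow> E2 *v x \<in> V2 \<inter> Q"
    and "\<And>x. x \<in> Q \<Longrightarrow> R1 *v x = R2 *v x" "\<And>x. x \<in> Q \<Longrightarrow> R1 *v x \<in> Q"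
    and "\<And>x. x \<in> Q \<Longrightarrow> x - (E1 *v x + E2 *v x + R1 *v x) \<in> V1 \<inter> V2 \<inter> Q"
proof -
  define P1 P2 W where "P1 = V1 \<inter> Q" and "P2 = V2 \<inter> Q" and "W = V1 \<inter> V2 \<inter> Q"
  define S where "S = {x + y |x y. x \<in> P1 \<and> y \<in> P2}"
  have sub: "vec.subspace P1" "vec.subspace P2" "vec.subspace W" "vec.subspace S"
    unfolding P1_def P2_def W_def S_def
    by (intro vec.subspace_inter vec.subspace_sums V1 V2 Q)+
  obtain J :: "'a^'n^'n" where J: "\<And>x. x - J *v x \<in> S" "\<And>x. x \<in> S \<Longrightarrow> J *v x = 0"
    using exists_coprojection[OF sub(4)] by metis
  obtain N :: "'a^'n^'n" where N: "\<And>x. x - N *v x \<in> W" "\<And>x. x \<in> W \<Longrightarrow> N *v x = 0"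
    using exists_coprojection[OF sub(3)] by metis
  have P1S: "x \<in> S" if "x \<in> P1" for x
    using that vec.subspace_0[OF sub(2)] by (force simp: S_def)
  have P2S: "x \<in> S" if "x \<in> P2" for x
    using that vec.subspace_0[OF sub(1)] by (force simp: S_def)
  \<comment> \<open>\<open>P1\<close> and \<open>P2\<close> meet in \<open>W\<close>, where
    \<open>N\<close> vanishes, so \<open>N\<close> on one and zero on the other are
    compatible.\<close>
  obtain C1 :: "'a^'n^'n" where C1: "\<And>x. x \<in> P1 \<Longrightarrow> C1 *v x = N *v x" "\<And>x. x \<in> P2 \<Longrightarrow> C1 *v x = 0"
    using exists_matrix_eq_on_zero_on[OF sub(1) sub(2), of N] N(2) by (auto simp: P1_def P2_def W_def)
  obtain C2 :: "'a^'n^'n" where C2: "\<And>x. x \<in> P2 \<Longrightarrow> C2 *v x = N *v x" "\<And>x. x \<in> P1 \<Longrightarrow> C2 *v x = 0"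
    using exists_matrix_eq_on_zero_on[OF sub(2) sub(1), of N] N(2) by (auto simp: P1_def P2_def W_def)
  \<comment> \<open>\<open>x - J *v x\<close> is a sum of some \<open>p\<close> in \<open>P1\<close>
    and \<open>q\<close> in \<open>P2\<close>, unique only modulo \<open>W\<close>.
    \<open>C1\<close> and \<open>C2\<close> turn it into \<open>N *v p\<close> and
    \<open>N *v q\<close>, which do not depend on the choice.\<close>
  define c1 where "c1 = C1 ** (mat 1 - J)"
  define c2 where "c2 = C2 ** (mat 1 - J)"
  have c1: "c1 *v x = C1 *v (x - J *v x)" and c2: "c2 *v x = C2 *v (x - J *v x)" for x
    by (simp_all add: c1_def c2_def matrix_vector_mult_diff_rdistrib flip: matrix_vector_mul_assoc)
  \<comment> \<open>The overlap of \<open>Q\<close> and \<open>V2\<close> is \<open>P2\<close>,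
    where \<open>J\<close> and \<open>C1\<close> vanish and hence so does \<open>c1\<close>. The
    next three extensions are justified alike; \<open>J\<close> vanishes on both \<open>P1\<close>
    and \<open>P2\<close>.\<close>
  obtain E1 :: "'a^'n^'n" where E1: "\<And>x. x \<in> Q \<Longrightarrow> E1 *v x = c1 *v x" "\<And>x. x \<in> V2 \<Longrightarrow> E1 *v x = 0"
    using exists_matrix_eq_on_zero_on[OF Q V2, of c1] C1(2) J(2)[OF P2S] by (auto simp: c1 P2_def)
  obtain E2 :: "'a^'n^'n" where E2: "\<And>x. x \<in> Q \<Longrightarrow> E2 *v x = c2 *v x" "\<And>x. x \<in> V1 \<Longrightarrow> E2 *v x = 0"
    using exists_matrix_eq_on_zero_on[OF Q V1, of c2] C2(2) J(2)[OF P1S] by (auto simp: c2 P1_def)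
  obtain R1 :: "'a^'n^'n" where R1: "\<And>x. x \<in> Q \<Longrightarrow> R1 *v x = J *v x" "\<And>x. x \<in> V1 \<Longrightarrow> R1 *v x = 0"
    using exists_matrix_eq_on_zero_on[OF Q V1, of J] J(2)[OF P1S] by (auto simp: P1_def)
  obtain R2 :: "'a^'n^'n" where R2: "\<And>x. x \<in> Q \<Longrightarrow> R2 *v x = J *v x" "\<And>x. x \<in> V2 \<Longrightarrow> R2 *v x = 0"
    using exists_matrix_eq_on_zero_on[OF Q V2, of J] J(2)[OF P2S] by (auto simp: P2_def)
  have WP: "x \<in> P1" "x \<in> P2" if "x \<in> W" for x
    using that by (auto simp: W_def P1_def P2_def)
  have NP1: "N *v x \<in> P1" if "x \<in> P1" for x
    using vec.subspace_diff[OF sub(1) that WP(1)[OF N(1)[of x]]] by simp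
  have NP2: "N *v x \<in> P2" if "x \<in> P2" for x
    using vec.subspace_diff[OF sub(2) that WP(2)[OF N(1)[of x]]] by simp
  have split: "\<exists>p q. p \<in> P1 \<and> q \<in> P2 \<and> x - J *v x = p + q \<and> E1 *v x = N *v p \<and> E2 *v x = N *v q"
    if "x \<in> Q" for x
  proof -
    obtain p q where "p \<in> P1" "q \<in> P2" "x - J *v x = p + q"
      using J(1)[of x] by (auto simp: S_def)
    then show ?thesis
      using that by (intro exI[of _ p] exI[of _ q]) (simp add: E1 E2 c1 c2 C1 C2 matrix_vector_right_distrib)
  qed
  have JQ: "J *v x \<in> Q" if x: "x \<in> Q" for x
  proof -
    have "x - J *v x \<in> Q"
      using J(1)[of x] vec.subspace_add[OF Q] by (auto simp: S_def P1_def P2_def)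
    then show ?thesis
      using vec.subspace_diff[OF Q x, of "x - J *v x"] by simp
  qed
  show thesis
  proof (rule that[of E1 E2 R1 R2])
    fix x assume x: "x \<in> Q"
    from split[OF x] obtain p q where pq: "p \<in> P1" "q \<in> P2" "x - J *v x = p + q"
      "E1 *v x = N *v p" "E2 *v x = N *v q" by blast
    show "E1 *v x \<in> V1 \<inter> Q" "E2 *v x \<in> V2 \<inter> Q"
      using NP1 NP2 pq by (auto simp: P1_def P2_def)
    show "R1 *v x = R2 *v x" "R1 *v x \<in> Q"
      using R1 R2 JQ x by auto
    have "x - (E1 *v x + E2 *v x + R1 *v x) = (p - N *v p) + (q - N *v q)"
      using pq(3) by (simp add: pq(4,5) R1(1)[OF x] algebra_simps)
    also have "\<dots> \<in> W"
      by (rule vec.subspace_add[OF sub(3) N(1) N(1)])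
    finally show "x - (E1 *v x + E2 *v x + R1 *v x) \<in> V1 \<inter> V2 \<inter> Q"
      by (simp add: W_def)
  qed (use E1 E2 R1 R2 in auto)
qed

section \<open>Extending a bilinear form under vanishing conditions\<close>

lemma dotp_transpose_product:
  "dotp x ((transpose E ** D ** F) *v y) = dotp (E *v x) (D *v (F *v y))"
  by (simp add: dotp_vector_matrix flip: matrix_vector_mul_assoc transpose_matrix_vector)
     (metis dotp_vector_matrix vector_transpose_matrix)

text \<open>By \<open>DL\<close> and \<open>DR\<close>, \<open>D\<close> on \<open>L\<close> and
  \<open>R\<close> depends only on classes modulo the triple intersections. Splitting both arguments
  into three components gives nine terms, of which \<open>D1\<close> and \<open>D2\<close> remove
  two. The other seven can each be extended to vanish where required.\<close>

lemma extend_form_within_sum: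
  fixes L1 L2 L :: "('a::field^'m) set" and R1 R2 R :: "('a^'n) set" and D :: "'a^'n^'m"
  assumes sub: "vec.subspace L1" "vec.subspace L2" "vec.subspace L"
      "vec.subspace R1" "vec.subspace R2" "vec.subspace R"
    and D1: "\<And>x y. x \<in> L1 \<inter> L \<Longrightarrow> y \<in> R1 \<inter> R \<Longrightarrow> dotp x (D *v y) = 0"
    and D2: "\<And>x y. x \<in> L2 \<inter> L \<Longrightarrow> y \<in> R2 \<inter> R \<Longrightarrow> dotp x (D *v y) = 0"
    and DL: "\<And>x y. x \<in> L1 \<inter> L2 \<inter> L \<Longrightarrow> y \<in> R \<Longrightarrow> dotp x (D *v y) = 0"
    and DR: "\<And>x y. x \<in> L \<Longrightarrow> y \<in> R1 \<inter> R2 \<inter> R \<Longrightarrow> dotp x (D *v y) = 0"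
  obtains Y :: "'a^'n^'m" where "\<And>x y. x \<in> L1 \<Longrightarrow> y \<in> R1 \<Longrightarrow> dotp x (Y *v y) = 0"
    and "\<And>x y. x \<in> L2 \<Longrightarrow> y \<in> R2 \<Longrightarrow> dotp x (Y *v y) = 0"
    and "\<And>x y. x \<in> L \<Longrightarrow> y \<in> R \<Longrightarrow> dotp x (Y *v y) = dotp x (D *v y)"
proof -
  obtain E1 E2 F1 F2 :: "'a^'m^'m" where E:
    "\<And>x. x \<in> L2 \<Longrightarrow> E1 *v x = 0" "\<And>x. x \<in> L1 \<Longrightarrow> E2 *v x = 0"
    "\<And>x. x \<in> L1 \<Longrightarrow> F1 *v x = 0" "\<And>x. x \<in> L2 \<Longrightarrow> F2 *v x = 0"
    "\<And>x. x \<in> L \<Longrightarrow> E1 *v x \<in> L1 \<inter> L" "\<And>x. x \<in> L \<Longrightarrow> E2 *v x \<in> L2 \<inter> L"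
    "\<And>x. x \<in> L \<Longrightarrow> F1 *v x = F2 *v x" "\<And>x. x \<in> L \<Longrightarrow> F1 *v x \<in> L"
    "\<And>x. x \<in> L \<Longrightarrow> x - (E1 *v x + E2 *v x + F1 *v x) \<in> L1 \<inter> L2 \<inter> L"
    using exists_splitting_maps[OF sub(1-3)] by blast
  obtain G1 G2 H1 H2 :: "'a^'n^'n" where G:
    "\<And>x. x \<in> R2 \<Longrightarrow> G1 *v x = 0" "\<And>x. x \<in> R1 \<Longrightarrow> G2 *v x = 0"
    "\<And>x. x \<in> R1 \<Longrightarrow> H1 *v x = 0" "\<And>x. x \<in> R2 \<Longrightarrow> H2 *v x = 0"
    "\<And>x. x \<in> R \<Longrightarrow> G1 *v x \<in> R1 \<inter> R" "\<And>x. x \<in> R \<Longrightarrow> G2 *v x \<in> R2 \<inter> R"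
    "\<And>x. x \<in> R \<Longrightarrow> H1 *v x = H2 *v x" "\<And>x. x \<in> R \<Longrightarrow> H1 *v x \<in> R"
    "\<And>x. x \<in> R \<Longrightarrow> x - (G1 *v x + G2 *v x + H1 *v x) \<in> R1 \<inter> R2 \<inter> R"
    using exists_splitting_maps[OF sub(4-6)] by blast
  \<comment> \<open>The seven surviving terms. \<open>F1\<close>, \<open>F2\<close> and
    \<open>H1\<close>, \<open>H2\<close> are two extensions of the same residual components; in each
    product the choice is such that one factor vanishes on the \<open>L1\<close> or
    \<open>R1\<close> side and one on the \<open>L2\<close> or \<open>R2\<close> side.\<close>
  define Y where "Y = transpose E1 ** D ** (G2 + H1) + transpose E2 ** D ** (G1 + H2)
    + transpose F1 ** D ** (G1 + H2) + transpose F2 ** D ** G2"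
  have Y: "dotp x (Y *v y) = dotp (E1 *v x) (D *v (G2 *v y + H1 *v y)) + dotp (E2 *v x) (D *v (G1 *v y + H2 *v y))
    + dotp (F1 *v x) (D *v (G1 *v y + H2 *v y)) + dotp (F2 *v x) (D *v (G2 *v y))" for x y
    by (simp add: Y_def matrix_vector_mult_add_rdistrib dotp_add_right dotp_transpose_product)
  show thesis
  proof (rule that[of Y])
    fix x y assume "x \<in> L1" "y \<in> R1"
    then show "dotp x (Y *v y) = 0"
      by (simp add: Y E G)
  next
    fix x y assume "x \<in> L2" "y \<in> R2"
    then show "dotp x (Y *v y) = 0"
      by (simp add: Y E G)
  next
    fix x y assume x: "x \<in> L" and y: "y \<in> R"
    define x' where "x' = E1 *v x + E2 *v x + F1 *v x"
    define y' where "y' = G1 *v y + G2 *v y + H1 *v y"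
    have x': "x - x' \<in> L1 \<inter> L2 \<inter> L" and y': "y - y' \<in> R1 \<inter> R2 \<inter> R"
      using E(9)[OF x] G(9)[OF y] by (auto simp: x'_def y'_def)
    \<comment> \<open>The arguments are replaced one at a time: \<open>x\<close> by
      \<open>x'\<close> against \<open>y\<close> in \<open>R\<close>, then \<open>y\<close> by
      \<open>y'\<close> against \<open>x'\<close>, which must therefore lie in
      \<open>L\<close>.\<close>
    have "x' \<in> L"
      using vec.subspace_diff[OF sub(3) x, of "x - x'"] x' by simp
    then have "dotp x' (D *v (y - y')) = 0"
      using DR y' by blast
    moreover have "dotp (x - x') (D *v y) = 0"
      using DL x' y by blast
    ultimately have "dotp x (D *v y) = dotp x' (D *v y')"
      by (simp add: dotp_diff_left dotp_diff_right matrix_vector_mult_diff_distrib)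
    moreover have "dotp (E1 *v x) (D *v (G1 *v y)) = 0" "dotp (E2 *v x) (D *v (G2 *v y)) = 0"
      using D1 D2 E(5,6)[OF x] G(5,6)[OF y] by blast+
    ultimately show "dotp x (Y *v y) = dotp x (D *v y)"
      unfolding Y x'_def y'_def
      by (simp add: dotp_add_left dotp_add_right matrix_vector_right_distrib E(7)[OF x] G(7)[OF y])
  qed
qed

text \<open>The coprojection of \<open>U\<close> along its intersection with the sum of
  \<open>V1\<close> and \<open>V2\<close> vanishes on that intersection, so it can be extended to
  vanish on the whole sum.\<close>

lemma exists_sum_coprojection:
  fixes V1 V2 U :: "('a::field^'n) set"
  assumes V1: "vec.subspace V1" and V2: "vec.subspace V2" and U: "vec.subspace U"
  obtains E :: "'a^'n^'n" where "\<And>x. x \<in> V1 \<Longrightarrow> E *v x = 0" "\<And>x. x \<in> V2 \<Longrightarrow> E *v x = 0"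
    "\<And>x. x \<in> U \<Longrightarrow> x - E *v x \<in> U \<inter> {p + q |p q. p \<in> V1 \<and> q \<in> V2}"
proof -
  define S where "S = {p + q |p q. p \<in> V1 \<and> q \<in> V2}"
  have S: "vec.subspace S"
    unfolding S_def by (intro vec.subspace_sums V1 V2)
  have "vec.subspace (U \<inter> S)"
    by (rule vec.subspace_inter[OF U S])
  from exists_coprojection[OF this] obtain N :: "'a^'n^'n"
    where N: "\<And>x. x - N *v x \<in> U \<inter> S" "\<And>x. x \<in> U \<inter> S \<Longrightarrow> N *v x = 0" by metis
  obtain E :: "'a^'n^'n" where E: "\<And>x. x \<in> U \<Longrightarrow> E *v x = N *v x" "\<And>x. x \<in> S \<Longrightarrow> E *v x = 0"
    using exists_matrix_eq_on_zero_on[OF U S, of N] N(2) by auto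
  have "x \<in> S" if "x \<in> V1 \<or> x \<in> V2" for x
    using that vec.subspace_0[OF V1] vec.subspace_0[OF V2] by (force simp: S_def)
  then show thesis
    using E N(1) by (intro that[of E]) (auto simp: S_def)
qed

text \<open>Components outside the sums of \<open>L1\<close>, \<open>L2\<close> and of
  \<open>R1\<close>, \<open>R2\<close> can be isolated by maps that vanish on these sums, so there
  \<open>D\<close> itself may be kept. Only the parts of \<open>L\<close> and \<open>R\<close>
  inside the sums need the previous construction.\<close>

lemma extend_form:
  fixes L1 L2 L :: "('a::field^'m) set" and R1 R2 R :: "('a^'n) set" and D :: "'a^'n^'m"
  assumes sub: "vec.subspace L1" "vec.subspace L2" "vec.subspace L"
      "vec.subspace R1" "vec.subspace R2" "vec.subspace R"
    and D1: "\<And>x y. x \<in> L1 \<inter> L \<Longrightarrow> y \<in> R1 \<inter> R \<Longrightarrow> dotp x (D *v y) = 0"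
    and D2: "\<And>x y. x \<in> L2 \<inter> L \<Longrightarrow> y \<in> R2 \<inter> R \<Longrightarrow> dotp x (D *v y) = 0"
    and DL: "\<And>x p q. x \<in> L1 \<inter> L2 \<inter> L \<Longrightarrow> p \<in> R1 \<Longrightarrow> q \<in> R2 \<Longrightarrow> p + q \<in> R \<Longrightarrow> dotp x (D *v (p + q)) = 0"
    and DR: "\<And>p q y. p \<in> L1 \<Longrightarrow> q \<in> L2 \<Longrightarrow> p + q \<in> L \<Longrightarrow> y \<in> R1 \<inter> R2 \<inter> R \<Longrightarrow> dotp (p + q) (D *v y) = 0"
  obtains Z :: "'a^'n^'m" where "\<And>x y. x \<in> L1 \<Longrightarrow> y \<in> R1 \<Longrightarrow> dotp x (Z *v y) = 0"
    and "\<And>x y. x \<in> L2 \<Longrightarrow> y \<in> R2 \<Longrightarrow> dotp x (Z *v y) = 0"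
    and "\<And>x y. x \<in> L \<Longrightarrow> y \<in> R \<Longrightarrow> dotp x (Z *v y) = dotp x (D *v y)"
proof -
  define LS where "LS = L \<inter> {p + q |p q. p \<in> L1 \<and> q \<in> L2}"
  define RS where "RS = R \<inter> {p + q |p q. p \<in> R1 \<and> q \<in> R2}"
  have LS: "vec.subspace LS" and RS: "vec.subspace RS"
    unfolding LS_def RS_def by (intro vec.subspace_inter vec.subspace_sums sub)+
  \<comment> \<open>Every vector of \<open>LS\<close> or \<open>RS\<close> is a sum of the form
    \<open>p + q\<close>, so \<open>DL\<close> and \<open>DR\<close>, stated for such sums only,
    yield the hypotheses on all of \<open>LS\<close> and \<open>RS\<close>.\<close>
  obtain Y :: "'a^'n^'m" where Y: "\<And>x y. x \<in> L1 \<Longrightarrow> y \<in> R1 \<Longrightarrow> dotp x (Y *v y) = 0"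
    "\<And>x y. x \<in> L2 \<Longrightarrow> y \<in> R2 \<Longrightarrow> dotp x (Y *v y) = 0"
    "\<And>x y. x \<in> LS \<Longrightarrow> y \<in> RS \<Longrightarrow> dotp x (Y *v y) = dotp x (D *v y)"
  proof (rule extend_form_within_sum[OF sub(1,2) LS sub(4,5) RS, of D])
    fix x y
    show "x \<in> L1 \<inter> LS \<Longrightarrow> y \<in> R1 \<inter> RS \<Longrightarrow> dotp x (D *v y) = 0"
      by (rule D1) (auto simp: LS_def RS_def)
    show "x \<in> L2 \<inter> LS \<Longrightarrow> y \<in> R2 \<inter> RS \<Longrightarrow> dotp x (D *v y) = 0"
      by (rule D2) (auto simp: LS_def RS_def)
    show "x \<in> L1 \<inter> L2 \<inter> LS \<Longrightarrow> y \<in> RS \<Longrightarrow> dotp x (D *v y) = 0"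
      using DL unfolding LS_def RS_def by blast
    show "x \<in> LS \<Longrightarrow> y \<in> R1 \<inter> R2 \<inter> RS \<Longrightarrow> dotp x (D *v y) = 0"
      using DR unfolding LS_def RS_def by blast
  qed blast
  obtain E :: "'a^'m^'m" where E: "\<And>x. x \<in> L1 \<Longrightarrow> E *v x = 0" "\<And>x. x \<in> L2 \<Longrightarrow> E *v x = 0"
    "\<And>x. x \<in> L \<Longrightarrow> x - E *v x \<in> LS"
    using exists_sum_coprojection[OF sub(1-3)] unfolding LS_def by blast
  obtain F :: "'a^'n^'n" where F: "\<And>x. x \<in> R1 \<Longrightarrow> F *v x = 0" "\<And>x. x \<in> R2 \<Longrightarrow> F *v x = 0"
    "\<And>x. x \<in> R \<Longrightarrow> x - F *v x \<in> RS"
    using exists_sum_coprojection[OF sub(4-6)] unfolding RS_def by blast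
  \<comment> \<open>This expands \<open>D\<close> along \<open>x = E *v x + (x - E *v x)\<close> and
    the analogous splitting of \<open>y\<close> by \<open>F\<close>, with \<open>D\<close> replaced
    by \<open>Y\<close> in the last term. The first two terms vanish as soon as
    \<open>E *v x\<close> and \<open>F *v y\<close> do.\<close>
  define Z where "Z = transpose E ** D ** mat 1 + transpose (mat 1 - E) ** D ** F
    + transpose (mat 1 - E) ** Y ** (mat 1 - F)"
  have Z: "dotp x (Z *v y) = dotp (E *v x) (D *v y) + dotp (x - E *v x) (D *v (F *v y))
    + dotp (x - E *v x) (Y *v (y - F *v y))" for x y
    unfolding Z_def matrix_vector_mult_add_rdistrib dotp_add_right dotp_transpose_product
    by (simp add: matrix_vector_mult_diff_rdistrib)
  show thesis
  proof (rule that[of Z])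
    fix x y assume "x \<in> L" "y \<in> R"
    then have "dotp (x - E *v x) (Y *v (y - F *v y)) = dotp (x - E *v x) (D *v (y - F *v y))"
      by (intro Y(3) E(3) F(3))
    then show "dotp x (Z *v y) = dotp x (D *v y)"
      by (simp add: Z dotp_diff_left dotp_diff_right matrix_vector_mult_diff_distrib)
  qed (simp_all add: Z E F Y)
qed

section \<open>Block row vectors and the rank equation as a solvability criterion\<close>

definition vjoin :: "'a^'m \<Rightarrow> 'a^'p \<Rightarrow> 'a^('m + 'p)" where
  "vjoin x y = (\<chi> i. case i of Inl k \<Rightarrow> x $ k | Inr k \<Rightarrow> y $ k)"

lemma vjoin_eq_iff [simp]: "vjoin x y = vjoin x' y' \<longleftrightarrow> x = x' \<and> y = y'"
  by (auto simp: vjoin_def vec_eq_iff split: sum.splits)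

lemma exists_vjoin: "\<exists>x y. w = vjoin x y"
  by (rule exI[of _ "\<chi> i. w $ Inl i"], rule exI[of _ "\<chi> i. w $ Inr i"])
     (auto simp: vjoin_def vec_eq_iff split: sum.splits)

lemma ex_vjoin_iff: "(\<exists>w. P w) \<longleftrightarrow> (\<exists>x y. P (vjoin x y))"
  using exists_vjoin by metis

lemma all_vjoin_iff: "(\<forall>w. P w) \<longleftrightarrow> (\<forall>x y. P (vjoin x y))"
  using exists_vjoin by metis

lemma vjoin_add: "vjoin x y + vjoin x' y' = vjoin (x + x') (y + y')"
  by (auto simp: vjoin_def vec_eq_iff split: sum.splits)

lemma vjoin_0 [simp]: "vjoin 0 0 = 0"
  by (auto simp: vjoin_def vec_eq_iff split: sum.splits)

lemma vjoin_eq_0_iff [simp]: "vjoin x y = 0 \<longleftrightarrow> x = 0 \<and> y = 0"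
  using vjoin_eq_iff[of x y 0 0] by simp

lemma vjoin_vcat: "vjoin x y v* (A /// B) = x v* A + y v* (B :: 'a::field^'n^'p)"
  by (simp add: vec_eq_iff vector_matrix_mult_def vjoin_def vcat_def UNIV_Plus_UNIV[symmetric] sum.Plus
      del: UNIV_Plus_UNIV)

lemma vector_matrix_hcat: "x v* (A ||| B) = vjoin (x v* A) (x v* (B :: 'a::field^'n^'p))"
  by (auto simp: vec_eq_iff vector_matrix_mult_def vjoin_def hcat_def split: sum.splits)

lemma vector_matrix_mult_minus: "x v* (- A) = - (x v* (A :: 'a::field^'n^'m))"
  by (simp add: vec_eq_iff vector_matrix_mult_def sum_negf)

lemma vector_matrix_mult_minus_left: "(- x) v* A = - (x v* (A :: 'a::field^'n^'m))"
  by (simp add: vec_eq_iff vector_matrix_mult_def sum_negf)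

lemma rank_eq_dim_row_space:
  fixes A :: "'a::field^'n^'m"
  shows "rank A = vec.dim (range (\<lambda>y. y v* A))"
proof -
  have "rows A \<subseteq> range (\<lambda>y. y v* A)"
  proof
    fix r assume "r \<in> rows A"
    then obtain i where "r = row i A"
      by (auto simp: rows_def)
    then have "r = axis i 1 v* A"
      by (simp add: vec_eq_iff row_def vector_matrix_mult_def axis_def if_distrib[of "\<lambda>t. t * _"] cong: if_cong)
    then show "r \<in> range (\<lambda>y. y v* A)"
      by blast
  qed
  moreover have "range (\<lambda>y. y v* A) \<subseteq> vec.span (rows A)"
    using matrix_vector_mult_in_columnspace_gen[of "transpose A"] by auto
  ultimately show ?thesis
    unfolding row_rank_def_gen by (metis vec.dim_span vec.span_eq_dim vec.span_mono vec.span_span subset_antisym)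
qed

text \<open>Rank-nullity on a subspace: a linear section of \<open>f\<close> embeds the image as a
  complement \<open>H\<close> of the kernel \<open>K\<close> in \<open>S\<close>.\<close>

lemma dim_image_kernel:
  fixes f :: "'a::field^'n \<Rightarrow> 'a^'m"
  assumes f: "Vector_Spaces.linear (*s) (*s) f" and S: "vec.subspace S"
  shows "vec.dim (f ` S) + vec.dim {x \<in> S. f x = 0} = vec.dim S"
proof -
  interpret f: Vector_Spaces.linear "(*s)" "(*s)" f by fact
  obtain g where g: "range g \<subseteq> S" "Vector_Spaces.linear (*s) (*s) g" "\<And>v. v \<in> f ` S \<Longrightarrow> f (g v) = v"
    using vec.linear_exists_right_inverse_on[OF f S] by blast
  interpret g: Vector_Spaces.linear "(*s)" "(*s)" g by fact
  define H K where "H = g ` f ` S" and "K = {x \<in> S. f x = 0}"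
  have fS: "vec.subspace (f ` S)"
    by (rule f.subspace_image[OF S])
  have H: "vec.subspace H"
    unfolding H_def by (rule g.subspace_image[OF fS])
  have K: "vec.subspace K"
    using vec.subspace_inter[OF S f.subspace_kernel] by (simp add: K_def Int_def)
  have "inj_on g (f ` S)"
    using g(3) by (metis inj_onI)
  then have "vec.dim H = vec.dim (f ` S)"
    unfolding H_def using vec.dim_image_eq[OF g(2), of "f ` S"] vec.span_eq_iff[THEN iffD2, OF fS] by simp
  moreover have "{x + y |x y. x \<in> H \<and> y \<in> K} = S"
  proof (intro equalityI subsetI)
    fix x assume "x \<in> {x + y |x y. x \<in> H \<and> y \<in> K}"
    then show "x \<in> S"
      using g(1) vec.subspace_add[OF S] by (auto simp: H_def K_def)
  next
    fix x assume x: "x \<in> S"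
    then have "x - g (f x) \<in> K"
      using g vec.subspace_diff[OF S x, of "g (f x)"] by (auto simp: K_def f.diff)
    moreover have "g (f x) \<in> H"
      using x by (auto simp: H_def)
    moreover have "x = g (f x) + (x - g (f x))"
      by simp
    ultimately show "x \<in> {x + y |x y. x \<in> H \<and> y \<in> K}"
      by blast
  qed
  moreover have "H \<inter> K = {0}"
  proof
    show "H \<inter> K \<subseteq> {0}"
      using g(3) by (auto simp: H_def K_def)
    show "{0} \<subseteq> H \<inter> K"
      using vec.subspace_0[OF H] vec.subspace_0[OF K] by simp
  qed
  ultimately show ?thesis
    using vec.dim_sums_Int[OF H K] by (simp add: K_def)
qed

text \<open>\<open>P\<close> keeps the last two block columns and maps the row space of
  \<open>?M\<close> onto that of \<open>?S\<close>. Its kernel \<open>K\<close> there has dimension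
  \<open>rank ?M - rank ?S\<close> and contains the row space of \<open>?T\<close> padded with zeros
  by \<open>J\<close>. The rank equation thus says that \<open>K\<close> is no larger than this
  padded space.\<close>

lemma rank_block_eq_iff:
  fixes A\<^sub>1 :: "'a::field^'p1^'m1" and A\<^sub>2 :: "'a^'p2^'m2" and A\<^sub>3 :: "'a^'p3^'m3"
    and B\<^sub>1 :: "'a^'n^'m1" and B\<^sub>2 :: "'a^'n^'m2" and B\<^sub>3 :: "'a^'n^'m3"
    and C\<^sub>1 :: "'a^'p1^'k" and C\<^sub>2 :: "'a^'p2^'k" and C\<^sub>3 :: "'a^'p3^'k"
  shows "rank (A\<^sub>1 ||| 0 ||| 0 ||| B\<^sub>1 ||| B\<^sub>1
        /// 0 ||| - A\<^sub>2 ||| 0 ||| B\<^sub>2 ||| 0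
        /// 0 ||| 0 ||| - A\<^sub>3 ||| 0 ||| B\<^sub>3
        /// C\<^sub>1 ||| C\<^sub>2 ||| C\<^sub>3 ||| 0 ||| 0)
      = rank (B\<^sub>1 ||| B\<^sub>1
          /// B\<^sub>2 ||| 0
          /// 0 ||| B\<^sub>3)
      + rank (C\<^sub>1 ||| C\<^sub>2 ||| C\<^sub>3)
    \<longleftrightarrow> (\<forall>x y z. x v* B\<^sub>1 + y v* B\<^sub>2 = 0 \<longrightarrow> x v* B\<^sub>1 + z v* B\<^sub>3 = 0 \<longrightarrow>
          (\<exists>w. x v* A\<^sub>1 = w v* C\<^sub>1 \<and> - (y v* A\<^sub>2) = w v* C\<^sub>2 \<and> - (z v* A\<^sub>3) = w v* C\<^sub>3))"
  (is "rank ?M = rank ?S + rank ?T \<longleftrightarrow> ?C")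
proof -
  define f where "f = (\<lambda>u. u v* ?M)"
  define P :: "'a^('p1 + 'p2 + 'p3 + 'n + 'n) \<Rightarrow> 'a^('n + 'n)"
    where "P = (\<lambda>w. \<chi> i. w $ Inr (Inr (Inr i)))"
  define J :: "'a^('p1 + 'p2 + 'p3) \<Rightarrow> 'a^('p1 + 'p2 + 'p3 + 'n + 'n)"
    where "J = (\<lambda>w. \<chi> i. case i of Inl a \<Rightarrow> w $ Inl a | Inr b \<Rightarrow>
        (case b of Inl a \<Rightarrow> w $ Inr (Inl a) | Inr b \<Rightarrow>
          (case b of Inl a \<Rightarrow> w $ Inr (Inr a) | Inr b \<Rightarrow> 0)))"
  have f_vjoin: "f (vjoin x (vjoin y (vjoin z w))) =
      vjoin (x v* A\<^sub>1 + w v* C\<^sub>1) (vjoin (- (y v* A\<^sub>2) + w v* C\<^sub>2) (vjoin (- (z v* A\<^sub>3) + w v* C\<^sub>3)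
        (vjoin (x v* B\<^sub>1 + y v* B\<^sub>2) (x v* B\<^sub>1 + z v* B\<^sub>3))))" for x y z w
    by (simp add: f_def vjoin_vcat vector_matrix_hcat vjoin_add vector_matrix_mult_minus)
  have P_vjoin: "P (vjoin x (vjoin y (vjoin z w))) = w" for x y z w
    by (simp add: P_def vjoin_def)
  have J_vjoin: "J (vjoin x (vjoin y z)) = vjoin x (vjoin y (vjoin z 0))" for x y z
    by (auto simp: J_def vjoin_def vec_eq_iff split: sum.splits)
  have T: "w v* ?T = vjoin (w v* C\<^sub>1) (vjoin (w v* C\<^sub>2) (w v* C\<^sub>3))" for w
    by (simp add: vector_matrix_hcat)
  have f: "Vector_Spaces.linear (*s) (*s) f"
    unfolding f_def by (rule linear_vector_matrix_mult)
  have P: "Vector_Spaces.linear (*s) (*s) P"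
    by unfold_locales (auto simp: P_def vec_eq_iff algebra_simps)
  have J: "Vector_Spaces.linear (*s) (*s) J"
    by unfold_locales (auto simp: J_def vec_eq_iff algebra_simps split: sum.splits)
  interpret f: Vector_Spaces.linear "(*s)" "(*s)" f by fact
  interpret P: Vector_Spaces.linear "(*s)" "(*s)" P by fact
  interpret J: Vector_Spaces.linear "(*s)" "(*s)" J by fact
  have "inj J"
    unfolding inj_def all_vjoin_iff by (simp add: J_vjoin)
  define K where "K = {v \<in> range f. P v = 0}"
  define TR where "TR = range (\<lambda>w. w v* ?T)"
  have sub_f: "vec.subspace (range f)" and sub_TR: "vec.subspace TR"
    unfolding TR_def by (simp_all add: f.subspace_image vec.linear_subspace_image[OF linear_vector_matrix_mult])
  have sub_JT: "vec.subspace (J ` TR)"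
    by (rule J.subspace_image[OF sub_TR])
  have sub_K: "vec.subspace K"
    using vec.subspace_inter[OF sub_f P.subspace_kernel] by (simp add: K_def Int_def)
  \<comment> \<open>The bottom block row of \<open>?M\<close> is zero in the last two block columns,
    so its coefficient \<open>w\<close> drops out.\<close>
  have "P ` range f = range (\<lambda>u. u v* ?S)"
  proof (intro set_eqI)
    fix v
    have "v \<in> P ` range f \<longleftrightarrow> (\<exists>u. v = P (f u))"
      by auto
    also have "\<dots> \<longleftrightarrow> (\<exists>x y z w. v = P (f (vjoin x (vjoin y (vjoin z w)))))"
      by (simp only: ex_vjoin_iff)
    also have "\<dots> \<longleftrightarrow> (\<exists>x y z. v = vjoin x (vjoin y z) v* ?S)"
      unfolding f_vjoin P_vjoin by (simp add: vjoin_vcat vector_matrix_hcat vjoin_add)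
    also have "\<dots> \<longleftrightarrow> v \<in> range (\<lambda>u. u v* ?S)"
      by (simp only: image_iff bex_UNIV ex_vjoin_iff)
    finally show "v \<in> P ` range f \<longleftrightarrow> v \<in> range (\<lambda>u. u v* ?S)" .
  qed
  then have rank_M: "rank ?M = rank ?S + vec.dim K"
    using dim_image_kernel[OF P sub_f] by (simp add: rank_eq_dim_row_space K_def f_def)
  have JT_K: "J ` TR \<subseteq> K"
  proof
    fix v assume "v \<in> J ` TR"
    then obtain w where "v = vjoin (w v* C\<^sub>1) (vjoin (w v* C\<^sub>2) (vjoin (w v* C\<^sub>3) 0))"
      by (auto simp: TR_def T J_vjoin)
    then have "v = f (vjoin 0 (vjoin 0 (vjoin 0 w)))" "P v = 0"
      by (simp_all add: f_vjoin P_vjoin del: vjoin_0)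
    then show "v \<in> K"
      by (auto simp: K_def)
  qed
  have "vec.dim (J ` TR) = rank ?T"
    unfolding rank_eq_dim_row_space TR_def[symmetric]
    by (rule vec.dim_image_eq[OF J]) (rule inj_on_subset[OF \<open>inj J\<close> subset_UNIV])
  then have "rank ?M = rank ?S + rank ?T \<longleftrightarrow> vec.dim K = vec.dim (J ` TR)"
    unfolding rank_M by auto
  also have "\<dots> \<longleftrightarrow> K \<subseteq> J ` TR"
  proof
    assume "vec.dim K = vec.dim (J ` TR)"
    then show "K \<subseteq> J ` TR"
      using vec.subspace_dim_equal[OF sub_JT sub_K JT_K] by simp
  next
    assume "K \<subseteq> J ` TR"
    with JT_K have "K = J ` TR"
      by (intro equalityI)
    then show "vec.dim K = vec.dim (J ` TR)"
      by simp
  qed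
  also have "\<dots> \<longleftrightarrow> (\<forall>u. P (f u) = 0 \<longrightarrow> (\<exists>w'. f u = J (w' v* ?T)))"
    by (auto simp: K_def TR_def)
  also have "\<dots> \<longleftrightarrow> (\<forall>x y z w. P (f (vjoin x (vjoin y (vjoin z w)))) = 0 \<longrightarrow>
      (\<exists>w'. f (vjoin x (vjoin y (vjoin z w))) = J (w' v* ?T)))"
    by (simp only: all_vjoin_iff)
  also have "\<dots> \<longleftrightarrow> (\<forall>x y z w. x v* B\<^sub>1 + y v* B\<^sub>2 = 0 \<and> x v* B\<^sub>1 + z v* B\<^sub>3 = 0 \<longrightarrow>
      (\<exists>w'. x v* A\<^sub>1 + w v* C\<^sub>1 = w' v* C\<^sub>1 \<and> - (y v* A\<^sub>2) + w v* C\<^sub>2 = w' v* C\<^sub>2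
        \<and> - (z v* A\<^sub>3) + w v* C\<^sub>3 = w' v* C\<^sub>3))"
    unfolding f_vjoin P_vjoin T J_vjoin by (intro all_cong1 imp_cong ex_cong1; simp)
  \<comment> \<open>The contribution of the bottom block row already lies in the row space of
    \<open>?T\<close>: it can be absorbed into \<open>w'\<close>, which reduces to
    \<open>w = 0\<close>.\<close>
  also have "\<dots> \<longleftrightarrow> ?C"
  proof (intro iffI allI impI)
    fix x y z
    assume *: "\<forall>x y z w. x v* B\<^sub>1 + y v* B\<^sub>2 = 0 \<and> x v* B\<^sub>1 + z v* B\<^sub>3 = 0 \<longrightarrow>
      (\<exists>w'. x v* A\<^sub>1 + w v* C\<^sub>1 = w' v* C\<^sub>1 \<and> - (y v* A\<^sub>2) + w v* C\<^sub>2 = w' v* C\<^sub>2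
        \<and> - (z v* A\<^sub>3) + w v* C\<^sub>3 = w' v* C\<^sub>3)"
      and **: "x v* B\<^sub>1 + y v* B\<^sub>2 = 0" "x v* B\<^sub>1 + z v* B\<^sub>3 = 0"
    show "\<exists>w. x v* A\<^sub>1 = w v* C\<^sub>1 \<and> - (y v* A\<^sub>2) = w v* C\<^sub>2 \<and> - (z v* A\<^sub>3) = w v* C\<^sub>3"
      using *[rule_format, of x y z 0, OF conjI, OF **] by simp
  next
    fix x y z w
    assume ?C and "x v* B\<^sub>1 + y v* B\<^sub>2 = 0 \<and> x v* B\<^sub>1 + z v* B\<^sub>3 = 0"
    then obtain w' where "x v* A\<^sub>1 = w' v* C\<^sub>1" "- (y v* A\<^sub>2) = w' v* C\<^sub>2" "- (z v* A\<^sub>3) = w' v* C\<^sub>3"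
      by blast
    then show "\<exists>w'. x v* A\<^sub>1 + w v* C\<^sub>1 = w' v* C\<^sub>1 \<and> - (y v* A\<^sub>2) + w v* C\<^sub>2 = w' v* C\<^sub>2
        \<and> - (z v* A\<^sub>3) + w v* C\<^sub>3 = w' v* C\<^sub>3"
      by (intro exI[of _ "w' + w"]) (simp add: vector_matrix_left_distrib)
  qed
  finally show ?thesis .
qed

section \<open>Conjugation and Hermitian matrices\<close>

definition cnj_vec :: "complex^'n \<Rightarrow> complex^'n" where
  "cnj_vec x = (\<chi> i. cnj (x $ i))"

lemma cnj_vec_cnj_vec [simp]: "cnj_vec (cnj_vec x) = x"
  by (simp add: cnj_vec_def vec_eq_iff)

lemma cnj_vec_add: "cnj_vec (x + y) = cnj_vec x + cnj_vec y"
  by (simp add: cnj_vec_def vec_eq_iff)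

lemma conj_transpose_mult_vector: "conj_transpose B *v y = cnj_vec (cnj_vec y v* B)"
  by (simp add: vec_eq_iff conj_transpose_def cnj_vec_def matrix_vector_mult_def
      vector_matrix_mult_def mult.commute)

lemma dotp_cnj_vec: "dotp (cnj_vec x) (cnj_vec y) = cnj (dotp x y)"
  by (simp add: dotp_def cnj_vec_def)

lemma dotp_commute: "dotp x y = dotp y x"
  by (simp add: dotp_def mult.commute)

text \<open>Interchanging the arguments of a Hermitian form costs only conjugations. Since these
  exchange row spaces with column spaces of conjugate transposes, one vanishing condition yields its
  mirror image.\<close>

lemma dotp_hermitian:
  assumes "hermitian D"
  shows "dotp x (D *v y) = cnj (dotp (cnj_vec y) (D *v cnj_vec x))"
proof -
  have "D *v y = cnj_vec (cnj_vec y v* D)"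
    using assms conj_transpose_mult_vector[of D y] by (simp add: hermitian_def)
  then have "dotp x (D *v y) = cnj (dotp (cnj_vec x) (cnj_vec y v* D))"
    by (metis cnj_vec_cnj_vec dotp_cnj_vec)
  then show ?thesis
    by (simp only: dotp_commute[of "cnj_vec x"] dotp_vector_matrix)
qed

lemma cnj_vec_in_row_space_iff:
  "cnj_vec x \<in> range (\<lambda>y. y v* B) \<longleftrightarrow> x \<in> range ((*v) (conj_transpose B))"
  by (auto simp: image_iff conj_transpose_mult_vector) (metis cnj_vec_cnj_vec)+

lemma conj_transpose_mult: "conj_transpose (A ** B) = conj_transpose B ** conj_transpose A"
  by (simp add: vec_eq_iff conj_transpose_def matrix_matrix_mult_def mult.commute)

lemma conj_transpose_conj_transpose [simp]: "conj_transpose (conj_transpose A) = A"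
  by (simp add: vec_eq_iff conj_transpose_def)

lemma conj_transpose_add: "conj_transpose (A + B) = conj_transpose A + conj_transpose B"
  by (simp add: vec_eq_iff conj_transpose_def)

lemma conj_transpose_diff: "conj_transpose (A - B) = conj_transpose A - conj_transpose B"
  by (simp add: vec_eq_iff conj_transpose_def)

lemma conj_transpose_scaleR: "conj_transpose (c *\<^sub>R A) = c *\<^sub>R conj_transpose A"
  by (simp add: vec_eq_iff conj_transpose_def)

lemma matrix_add_rdistrib: "(A + B) ** C = A ** C + B ** (C :: 'a::semiring_1^'p^'n)"
  by (simp add: vec_eq_iff matrix_matrix_mult_def algebra_simps sum.distrib)

text \<open>As \<open>A\<close> is Hermitian, the conjugate transpose of a solution is a solution,
  and so is the average of the two.\<close>

lemma hermitian_part_solves: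
  assumes "B ** X ** conj_transpose B = A" "hermitian A"
  shows "B ** ((1/2) *\<^sub>R (X + conj_transpose X)) ** conj_transpose B = A"
proof -
  have "B ** conj_transpose X ** conj_transpose B = conj_transpose (B ** X ** conj_transpose B)"
    by (simp add: conj_transpose_mult matrix_mul_assoc)
  then have "B ** conj_transpose X ** conj_transpose B = A"
    using assms by (simp add: hermitian_def)
  moreover have "B ** ((1/2) *\<^sub>R (X + conj_transpose X)) ** conj_transpose B
      = (1/2) *\<^sub>R (B ** X ** conj_transpose B + B ** conj_transpose X ** conj_transpose B)"
    by (simp add: matrix_scalar_ac matrix_add_ldistrib matrix_add_rdistrib scaleR_right_distrib flip: scalar_matrix_assoc)
  ultimately show ?thesis
    using assms(1) by (simp flip: scaleR_2)
qed

section \<open>From pairwise solutions to a common solution\<close>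

lemma common_solution_if:
  fixes A\<^sub>1 :: "complex^'m1^'m1" and A\<^sub>2 :: "complex^'m2^'m2" and A\<^sub>3 :: "complex^'m3^'m3"
    and B\<^sub>1 :: "complex^'n^'m1" and B\<^sub>2 :: "complex^'n^'m2" and B\<^sub>3 :: "complex^'n^'m3"
  assumes X: "hermitian X" "B\<^sub>1 ** X ** conj_transpose B\<^sub>1 = A\<^sub>1" "B\<^sub>2 ** X ** conj_transpose B\<^sub>2 = A\<^sub>2"
    and Y: "hermitian Y" "B\<^sub>1 ** Y ** conj_transpose B\<^sub>1 = A\<^sub>1" "B\<^sub>3 ** Y ** conj_transpose B\<^sub>3 = A\<^sub>3"
    and W: "B\<^sub>2 ** W ** conj_transpose B\<^sub>2 = A\<^sub>2" "B\<^sub>3 ** W ** conj_transpose B\<^sub>3 = A\<^sub>3"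
    and ex: "\<And>x y z. x v* B\<^sub>1 + y v* B\<^sub>2 = 0 \<Longrightarrow> x v* B\<^sub>1 + z v* B\<^sub>3 = 0 \<Longrightarrow>
      \<exists>w. x v* A\<^sub>1 = w v* conj_transpose B\<^sub>1 \<and> - (y v* A\<^sub>2) = w v* conj_transpose B\<^sub>2
        \<and> - (z v* A\<^sub>3) = w v* conj_transpose B\<^sub>3"
  shows "\<exists>X. B\<^sub>1 ** X ** conj_transpose B\<^sub>1 = A\<^sub>1 \<and> B\<^sub>2 ** X ** conj_transpose B\<^sub>2 = A\<^sub>2
      \<and> B\<^sub>3 ** X ** conj_transpose B\<^sub>3 = A\<^sub>3"
proof -
  let ?C = "conj_transpose"
  note solves = matrix_product_eq_iff_dotp[THEN iffD1, rule_format]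
  define L1 L2 L3 where "L1 = range (\<lambda>y. y v* B\<^sub>1)" and "L2 = range (\<lambda>y. y v* B\<^sub>2)"
    and "L3 = range (\<lambda>y. y v* B\<^sub>3)"
  define R1 R2 R3 where "R1 = range ((*v) (?C B\<^sub>1))" and "R2 = range ((*v) (?C B\<^sub>2))"
    and "R3 = range ((*v) (?C B\<^sub>3))"
  have sub: "vec.subspace L1" "vec.subspace L2" "vec.subspace L3"
      "vec.subspace R1" "vec.subspace R2" "vec.subspace R3"
    unfolding L1_def L2_def L3_def R1_def R2_def R3_def
    by (simp_all add: vec.linear_subspace_image[OF linear_vector_matrix_mult] vec.subspace_image)
  have LR: "cnj_vec x \<in> L1 \<longleftrightarrow> x \<in> R1" "cnj_vec x \<in> L2 \<longleftrightarrow> x \<in> R2" "cnj_vec x \<in> L3 \<longleftrightarrow> x \<in> R3" for x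
    by (simp_all only: L1_def L2_def L3_def R1_def R2_def R3_def cnj_vec_in_row_space_iff)
  define D where "D = Y - X"
  have D: "dotp x (D *v y) = dotp x (Y *v y) - dotp x (X *v y)" for x y
    by (simp add: D_def matrix_vector_mult_diff_rdistrib dotp_diff_right)
  have "hermitian D"
    using X(1) Y(1) by (simp add: D_def hermitian_def conj_transpose_diff)
  have DL: "dotp x (D *v (p + q)) = 0"
    if x: "x \<in> L1 \<inter> L2 \<inter> L3" and p: "p \<in> R1" and q: "q \<in> R2" and pq: "p + q \<in> R3" for x p q
  proof -
    obtain a b c where x: "x = a v* B\<^sub>1" "x = b v* B\<^sub>2" "x = c v* B\<^sub>3"
      using x unfolding L1_def L2_def L3_def by blast
    obtain a' b' c' where y: "p = ?C B\<^sub>1 *v a'" "q = ?C B\<^sub>2 *v b'" "p + q = ?C B\<^sub>3 *v c'"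
      using p q pq unfolding R1_def R2_def R3_def by blast
    \<comment> \<open>The three representations of \<open>x\<close> form a relation as in
      \<open>ex\<close>; the negated coefficients cancel the signs in its conclusion.\<close>
    have "a v* B\<^sub>1 + (- b) v* B\<^sub>2 = 0" "a v* B\<^sub>1 + (- c) v* B\<^sub>3 = 0"
      by (simp_all add: vector_matrix_mult_minus_left flip: x)
    from ex[OF this] obtain w
      where w: "a v* A\<^sub>1 = w v* ?C B\<^sub>1" "b v* A\<^sub>2 = w v* ?C B\<^sub>2" "c v* A\<^sub>3 = w v* ?C B\<^sub>3"
      by (auto simp: vector_matrix_mult_minus_left)
    \<comment> \<open>The same \<open>w\<close> represents all three pairings: \<open>X\<close> on
      \<open>p\<close> by the first equation, \<open>X\<close> on \<open>q\<close> by the second,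
      \<open>Y\<close> on \<open>p + q\<close> by the third. Hence \<open>X\<close> and
      \<open>Y\<close> agree on \<open>p + q\<close>.\<close>
    have Xp: "dotp x (X *v p) = dotp w p"
      unfolding x(1) y(1) solves[OF X(2)] by (simp add: w(1) flip: dotp_vector_matrix)
    have Xq: "dotp x (X *v q) = dotp w q"
      unfolding x(2) y(2) solves[OF X(3)] by (simp add: w(2) flip: dotp_vector_matrix)
    have "dotp x (Y *v (p + q)) = dotp w (p + q)"
      unfolding x(3) y(3) solves[OF Y(3)] by (simp add: w(3) flip: dotp_vector_matrix)
    also have "\<dots> = dotp x (X *v (p + q))"
      by (simp only: matrix_vector_right_distrib dotp_add_right Xp Xq)
    finally show ?thesis
      by (simp only: D diff_self)
  qed
  obtain Z where Z: "\<And>x y. x \<in> L1 \<Longrightarrow> y \<in> R1 \<Longrightarrow> dotp x (Z *v y) = 0"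
    "\<And>x y. x \<in> L2 \<Longrightarrow> y \<in> R2 \<Longrightarrow> dotp x (Z *v y) = 0"
    "\<And>x y. x \<in> L3 \<Longrightarrow> y \<in> R3 \<Longrightarrow> dotp x (Z *v y) = dotp x (D *v y)"
  proof (rule extend_form[OF sub])
    fix x y assume "x \<in> L1 \<inter> L3" "y \<in> R1 \<inter> R3"
    then obtain a b where "x = a v* B\<^sub>1" "y = ?C B\<^sub>1 *v b"
      by (auto simp: L1_def R1_def)
    then show "dotp x (D *v y) = 0"
      by (simp add: D solves[OF X(2)] solves[OF Y(2)])
  next
    fix x y assume xy: "x \<in> L2 \<inter> L3" "y \<in> R2 \<inter> R3"
    then obtain a b where ab: "x = a v* B\<^sub>2" "y = ?C B\<^sub>2 *v b"
      by (auto simp: L2_def R2_def)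
    obtain c d where cd: "x = c v* B\<^sub>3" "y = ?C B\<^sub>3 *v d"
      using xy by (auto simp: L3_def R3_def)
    \<comment> \<open>\<open>W\<close> links the two: it agrees with \<open>X\<close> here by the
      second equation and with \<open>Y\<close> by the third.\<close>
    have "dotp x (X *v y) = dotp x (W *v y)"
      unfolding ab solves[OF X(3)] solves[OF W(1)] ..
    moreover have "dotp x (Y *v y) = dotp x (W *v y)"
      unfolding cd solves[OF Y(3)] solves[OF W(2)] ..
    ultimately show "dotp x (D *v y) = 0"
      by (simp add: D)
  next
    fix p q y assume "p \<in> L1" "q \<in> L2" "p + q \<in> L3" "y \<in> R1 \<inter> R2 \<inter> R3"
    \<comment> \<open>The mirrored condition is \<open>DL\<close> for the conjugated vectors,
      carried over by \<open>dotp_hermitian\<close>.\<close>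
    then have "dotp (cnj_vec y) (D *v (cnj_vec p + cnj_vec q)) = 0"
      by (intro DL) (simp_all add: LR flip: LR cnj_vec_add)
    then show "dotp (p + q) (D *v y) = 0"
      by (simp add: dotp_hermitian[OF \<open>hermitian D\<close>, of "p + q"] cnj_vec_add)
  qed (rule DL, assumption+, blast)
  have XZ: "dotp x ((X + Z) *v y) = dotp x (X *v y) + dotp x (Z *v y)" for x y
    by (simp add: matrix_vector_mult_add_rdistrib dotp_add_right)
  show ?thesis
  \<comment> \<open>\<open>Z\<close> leaves the values of \<open>X\<close> for the first two
    equations unchanged and adds \<open>Y - X\<close> for the third.\<close>
  proof (intro exI[of _ "X + Z"] conjI; unfold matrix_product_eq_iff_dotp; intro allI)
    fix x y
    show "dotp (x v* B\<^sub>1) ((X + Z) *v (?C B\<^sub>1 *v y)) = dotp x (A\<^sub>1 *v y)"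
      unfolding XZ solves[OF X(2)] by (simp add: Z(1) L1_def R1_def)
  next
    fix x y
    show "dotp (x v* B\<^sub>2) ((X + Z) *v (?C B\<^sub>2 *v y)) = dotp x (A\<^sub>2 *v y)"
      unfolding XZ solves[OF X(3)] by (simp add: Z(2) L2_def R2_def)
  next
    fix x y
    show "dotp (x v* B\<^sub>3) ((X + Z) *v (?C B\<^sub>3 *v y)) = dotp x (A\<^sub>3 *v y)"
      unfolding XZ by (simp add: Z(3) L3_def R3_def D solves[OF Y(3)])
  qed
qed

theorem corollary3p5:
  fixes A\<^sub>1 :: "complex^'m1^'m1" and A\<^sub>2 :: "complex^'m2^'m2" and A\<^sub>3 :: "complex^'m3^'m3"
    and B\<^sub>1 :: "complex^'n^'m1" and B\<^sub>2 :: "complex^'n^'m2" and B\<^sub>3 :: "complex^'n^'m3"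
  assumes "hermitian A\<^sub>1" and "hermitian A\<^sub>2" and "hermitian A\<^sub>3"
    and "\<exists>X. hermitian X \<and> B\<^sub>1 ** X ** conj_transpose B\<^sub>1 = A\<^sub>1
                       \<and> B\<^sub>2 ** X ** conj_transpose B\<^sub>2 = A\<^sub>2"
    and "\<exists>X. hermitian X \<and> B\<^sub>1 ** X ** conj_transpose B\<^sub>1 = A\<^sub>1
                       \<and> B\<^sub>3 ** X ** conj_transpose B\<^sub>3 = A\<^sub>3"
    and "\<exists>X. hermitian X \<and> B\<^sub>2 ** X ** conj_transpose B\<^sub>2 = A\<^sub>2
                       \<and> B\<^sub>3 ** X ** conj_transpose B\<^sub>3 = A\<^sub>3"
  shows "(\<exists>X :: complex^'n^'n. hermitian X \<and> B\<^sub>1 ** X ** conj_transpose B\<^sub>1 = A\<^sub>1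
                                \<and> B\<^sub>2 ** X ** conj_transpose B\<^sub>2 = A\<^sub>2
                                \<and> B\<^sub>3 ** X ** conj_transpose B\<^sub>3 = A\<^sub>3)
    \<longleftrightarrow>
      rank (A\<^sub>1 ||| 0 ||| 0 ||| B\<^sub>1 ||| B\<^sub>1
        /// 0 ||| - A\<^sub>2 ||| 0 ||| B\<^sub>2 ||| 0
        /// 0 ||| 0 ||| - A\<^sub>3 ||| 0 ||| B\<^sub>3
        /// conj_transpose B\<^sub>1 ||| conj_transpose B\<^sub>2 ||| conj_transpose B\<^sub>3 ||| 0 ||| 0)
      = rank (B\<^sub>1 ||| B\<^sub>1
          /// B\<^sub>2 ||| 0
          /// 0 ||| B\<^sub>3)
      + rank (conj_transpose B\<^sub>1 ||| conj_transpose B\<^sub>2 ||| conj_transpose B\<^sub>3)"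
  unfolding rank_block_eq_iff
proof (intro iffI allI impI)
  fix x y z
  assume "\<exists>X :: complex^'n^'n. hermitian X \<and> B\<^sub>1 ** X ** conj_transpose B\<^sub>1 = A\<^sub>1
    \<and> B\<^sub>2 ** X ** conj_transpose B\<^sub>2 = A\<^sub>2 \<and> B\<^sub>3 ** X ** conj_transpose B\<^sub>3 = A\<^sub>3"
  then obtain X where X: "B\<^sub>1 ** X ** conj_transpose B\<^sub>1 = A\<^sub>1"
    "B\<^sub>2 ** X ** conj_transpose B\<^sub>2 = A\<^sub>2" "B\<^sub>3 ** X ** conj_transpose B\<^sub>3 = A\<^sub>3" by blast
  assume "x v* B\<^sub>1 + y v* B\<^sub>2 = 0" "x v* B\<^sub>1 + z v* B\<^sub>3 = 0"
  then have "y v* B\<^sub>2 = - (x v* B\<^sub>1)" "z v* B\<^sub>3 = - (x v* B\<^sub>1)"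
    by (simp_all add: add_eq_0_iff)
  \<comment> \<open>One vector serves all three: \<open>x v* B\<^sub>1\<close> equals the negatives
    of \<open>y v* B\<^sub>2\<close> and \<open>z v* B\<^sub>3\<close>, and applying
    \<open>X\<close> and then the conjugate transposes produces the required left-hand
    sides.\<close>
  then show "\<exists>w. x v* A\<^sub>1 = w v* conj_transpose B\<^sub>1 \<and> - (y v* A\<^sub>2) = w v* conj_transpose B\<^sub>2
      \<and> - (z v* A\<^sub>3) = w v* conj_transpose B\<^sub>3"
    by (intro exI[of _ "x v* B\<^sub>1 v* X"])
       (simp add: vector_matrix_mult_minus_left flip: X vector_matrix_mul_assoc)
next
  assume "\<forall>x y z. x v* B\<^sub>1 + y v* B\<^sub>2 = 0 \<longrightarrow> x v* B\<^sub>1 + z v* B\<^sub>3 = 0 \<longrightarrow>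
      (\<exists>w. x v* A\<^sub>1 = w v* conj_transpose B\<^sub>1 \<and> - (y v* A\<^sub>2) = w v* conj_transpose B\<^sub>2
        \<and> - (z v* A\<^sub>3) = w v* conj_transpose B\<^sub>3)"
  then have ex: "\<exists>w. x v* A\<^sub>1 = w v* conj_transpose B\<^sub>1 \<and> - (y v* A\<^sub>2) = w v* conj_transpose B\<^sub>2
        \<and> - (z v* A\<^sub>3) = w v* conj_transpose B\<^sub>3"
    if "x v* B\<^sub>1 + y v* B\<^sub>2 = 0" "x v* B\<^sub>1 + z v* B\<^sub>3 = 0" for x y z
    using that by blast
  obtain X\<^sub>1\<^sub>2 where X12: "hermitian X\<^sub>1\<^sub>2" "B\<^sub>1 ** X\<^sub>1\<^sub>2 ** conj_transpose B\<^sub>1 = A\<^sub>1"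
    "B\<^sub>2 ** X\<^sub>1\<^sub>2 ** conj_transpose B\<^sub>2 = A\<^sub>2"
    using assms(4) by blast
  obtain X\<^sub>1\<^sub>3 where X13: "hermitian X\<^sub>1\<^sub>3" "B\<^sub>1 ** X\<^sub>1\<^sub>3 ** conj_transpose B\<^sub>1 = A\<^sub>1"
    "B\<^sub>3 ** X\<^sub>1\<^sub>3 ** conj_transpose B\<^sub>3 = A\<^sub>3"
    using assms(5) by blast
  obtain X\<^sub>2\<^sub>3 where X23: "B\<^sub>2 ** X\<^sub>2\<^sub>3 ** conj_transpose B\<^sub>2 = A\<^sub>2"
    "B\<^sub>3 ** X\<^sub>2\<^sub>3 ** conj_transpose B\<^sub>3 = A\<^sub>3"
    using assms(6) by blast
  obtain X where X: "B\<^sub>1 ** X ** conj_transpose B\<^sub>1 = A\<^sub>1"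
    "B\<^sub>2 ** X ** conj_transpose B\<^sub>2 = A\<^sub>2" "B\<^sub>3 ** X ** conj_transpose B\<^sub>3 = A\<^sub>3"
    using common_solution_if[OF X12 X13 X23 ex] by blast
  have "hermitian ((1/2) *\<^sub>R (X + conj_transpose X))"
    by (simp add: hermitian_def conj_transpose_scaleR conj_transpose_add add.commute)
  with X[THEN hermitian_part_solves] assms(1-3) show "\<exists>X. hermitian X \<and> B\<^sub>1 ** X ** conj_transpose B\<^sub>1 = A\<^sub>1
    \<and> B\<^sub>2 ** X ** conj_transpose B\<^sub>2 = A\<^sub>2 \<and> B\<^sub>3 ** X ** conj_transpose B\<^sub>3 = A\<^sub>3"
    by (intro exI[of _ "(1/2) *\<^sub>R (X + conj_transpose X)"] conjI)
qed

end
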